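(* Let $\mathcal{H}$ be a real Hilbert space, let $m\in\mathbb{N}\smallsetminus\{0\}$, let $T_1,\ldots,T_m$ be linear isometries from $\mathcal{H}$ to $\mathcal{H}$ with $T_1=\mathrm{Id}$, and let $\mathcal{S}=\{T_1,T_2,\ldots,T_m\}$. Let $W$ be a closed linear subspace of $\mathcal{H}$ with $W\subseteq\bigcap_{i=1}^m\operatorname{Fix}T_i$. Let $F:\mathcal{H}\to\mathcal{H}$ satisfy $Fx\in\operatorname{aff}(\mathcal{S}(x))$ for every $x\in\mathcal{H}$. Let $T:\mathcal{H}\to\mathcal{H}$ be bounded and linear with $\mathrm{P}_WT=\mathrm{P}_W=T\mathrm{P}_W$. Let $\gamma\in[0,1[$ and assume that one of the following holds: (i) for every $x\in\mathcal{H}$, $\|Fx-\mathrm{P}_Wx\|\le\gamma\|x-\mathrm{P}_Wx\|$; (ii) for every $x\in\mathcal{H}$, $\|Fx-\mathrm{P}_{\operatorname{Fix}F}x\|\le\gamma\|x-\mathrm{P}_{\operatorname{Fix}F}x\|$, and for every $k\in\mathbb{N}$, $\mathrm{P}_{\operatorname{Fix}F}\,CC_{\mathcal{S}}^k\,T=\mathrm{P}_W$. Then for every $x\in\mathcal{H}$ and every $k\in\mathbb{N}$, $$\|CC_{\mathcal{S}}^kTx-\mathrm{P}_Wx\|\le\gamma^k\,\|T\mathrm{P}_{W^\perp}\|\,\|x-\mathrm{P}_Wx\|.$$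
   Context: $\mathbb{N}=\{0,1,2,\ldots\}$, and $\gamma^0=1$ also for $\gamma=0$. A map $T:\mathcal{H}\to\mathcal{H}$ is an isometry if $\|Tx-Ty\|=\|x-y\|$ for all $x,y$. $\operatorname{Fix}T=\{x:Tx=x\}$. $\mathrm{P}_C$ is the projector (best approximation operator) onto $C$; hypothesis (ii) presupposes that $\mathrm{P}_{\operatorname{Fix}F}$ is well defined (every point of $\mathcal{H}$ has a unique best approximation in $\operatorname{Fix}F$). $W^\perp$ is the orthogonal complement; $\|\cdot\|$ of a bounded linear operator is the operator norm; $\operatorname{aff}$ denotes affine hull. Circumcenter mapping: for a finite set $\mathcal{S}$ of isometries of $\mathcal{H}$ having a common fixed point, and $x\in\mathcal{H}$, let $\mathcal{S}(x)=\{Tx: T\in\mathcal{S}\}$. It is known that there is a unique point $CC_{\mathcal{S}}(x)$ that lies in $\operatorname{aff}(\mathcal{S}(x))$ and is equidistant from all points of $\mathcal{S}(x)$; this defines the circumcenter mapping $CC_{\mathcal{S}}:\mathcal{H}\to\mathcal{H}$. $CC_{\mathcal{S}}^k$ is its $k$-fold composition. *)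

theory Defs
  imports "HOL-Analysis.Analysis"
begin

text \<open>
  Real Hilbert spaces are rendered by the sort \<open>{real_inner, complete_space}\<close>. The library's
  \<open>closest_point\<close> is restricted to \<open>heine_borel\<close>, which excludes infinite-dimensional
  spaces, so the projector is defined here.
\<close>

definition is_isometry :: "('a::real_normed_vector \<Rightarrow> 'a) \<Rightarrow> bool"
  where "is_isometry T \<longleftrightarrow> (\<forall>x y. norm (T x - T y) = norm (x - y))"

definition Fix :: "('a \<Rightarrow> 'a) \<Rightarrow> 'a set"
  where "Fix T = {x. T x = x}"

definition best_approx :: "'a::metric_space set \<Rightarrow> 'a \<Rightarrow> 'a \<Rightarrow> bool"
  where "best_approx C x p \<longleftrightarrow> p \<in> C \<and> (\<forall>y\<in>C. dist x p \<le> dist x y)"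

text \<open>\<open>proj_defined C\<close> says that the projector onto \<open>C\<close> is well defined on the whole space;
  otherwise \<open>proj C x\<close> may be an unspecified value.\<close>

definition proj_defined :: "'a::metric_space set \<Rightarrow> bool"
  where "proj_defined C \<longleftrightarrow> (\<forall>x. \<exists>!p. best_approx C x p)"

definition proj :: "'a::metric_space set \<Rightarrow> 'a \<Rightarrow> 'a"
  where "proj C x = (THE p. best_approx C x p)"

definition orbit_set :: "('a \<Rightarrow> 'a) set \<Rightarrow> 'a \<Rightarrow> 'a set"
  where "orbit_set S x = {T x | T. T \<in> S}"

definition is_circumcenter :: "'a::real_normed_vector set \<Rightarrow> 'a \<Rightarrow> bool"
  where "is_circumcenter K p \<longleftrightarrow>
    p \<in> affine hull K \<and> (\<forall>y\<in>K. \<forall>z\<in>K. dist p y = dist p z)"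

text \<open>The description below is proper whenever \<open>S\<close> is a nonempty finite set of isometries of a
  real Hilbert space with a common fixed point.\<close>

definition CC :: "('a::real_normed_vector \<Rightarrow> 'a) set \<Rightarrow> 'a \<Rightarrow> 'a"
  where "CC S x = (THE p. is_circumcenter (orbit_set S x) p)"

end

theory Submission
  imports Defs
begin

text \<open>
  The circumcenter is a best approximation in disguise. If the points of \<open>K\<close> are equidistant
  from \<open>z\<close> as well as from a point \<open>p\<close> of \<open>affine hull K\<close>, then \<open>z - p\<close> is orthogonal to the
  directions of the hull, so \<open>p\<close> is the point of the hull nearest to \<open>z\<close>
  (\<open>circumcenter_nearest\<close>). The isometries fix \<open>w \<in> W\<close>, so every orbit set
  lies on a sphere around \<open>w\<close>, and hence \<open>norm (CC S x - w) \<le> norm (F x - w)\<close>: the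
  circumcenter mapping is at least as good as any \<open>F\<close> with values in the affine hulls, whichever
  point of \<open>W\<close> is to be approximated.

  A contraction property of \<open>F\<close> thus passes to the iterates \<open>CC S ^^ k \<circ> T\<close>, provided that the
  target of \<open>F\<close> does not move along the iteration. In the second alternative of the theorem
  the target is the projection of the iterate onto \<open>Fix F\<close>, assumed to be \<open>proj W x\<close>. In the
  first one it is the projection of the iterate onto \<open>W\<close>, and this is \<open>proj W x\<close> because linear
  isometries \<open>f\<close> preserve inner products: \<open>inner (f y) w = inner (f y) (f w) = inner y w\<close> for
  \<open>f \<in> S\<close> and \<open>w \<in> W\<close>, so \<open>proj W\<close> is constant on each orbit set and on its affine hull. By induction on \<open>k\<close> the error at step \<open>k\<close> is
  at most \<open>\<gamma> ^ k * norm (T x - proj W x)\<close>. Finally \<open>T x - proj W x = T (x - proj W x)\<close>, and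
  \<open>x - proj W x\<close> is its own projection onto the orthogonal complement of \<open>W\<close>, which brings in the
  operator norm.
\<close>

section \<open>Projection onto a closed subspace of a Hilbert space\<close>

text \<open>The parallelogram law makes a minimizing sequence Cauchy, and its limit is a nearest point.
  A nearest point \<open>p\<close> has an orthogonal residual, since otherwise moving from \<open>p\<close> along the offending
  direction would shorten the residual.\<close>

lemma closed_subspace_orthogonal_decomposition:
  fixes W :: "'a::{real_inner, complete_space} set"
  assumes sub: "subspace W" and cl: "closed W"
  shows "\<exists>p\<in>W. \<forall>y\<in>W. inner (x - p) y = 0"
proof -
  define d where "d = infdist x W"
  have ne: "W \<noteq> {}" using subspace_0[OF sub] by auto
  have d0: "0 \<le> d" by (simp add: d_def infdist_nonneg)
  have dle: "d \<le> norm (x - y)" if "y \<in> W" for y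
    using infdist_le[OF that, of x] by (simp add: d_def dist_norm)
  have dle2: "d\<^sup>2 \<le> (norm (x - y))\<^sup>2" if "y \<in> W" for y
    using dle[OF that] d0 by (rule power_mono)
  have "\<exists>p\<in>W. (norm (x - p))\<^sup>2 < d\<^sup>2 + inverse (real (Suc n))" for n
  proof -
    have "d < sqrt (d\<^sup>2 + inverse (real (Suc n)))"
      by (rule real_less_rsqrt) simp
    then obtain p where p: "p \<in> W" "dist x p < sqrt (d\<^sup>2 + inverse (real (Suc n)))"
      using ne unfolding d_def infdist_notempty[OF ne]
      by (meson cINF_less_iff bdd_below_image_dist)
    have "(norm (x - p))\<^sup>2 < (sqrt (d\<^sup>2 + inverse (real (Suc n))))\<^sup>2"
      using p(2) by (intro power_strict_mono) (auto simp: dist_norm)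
    also have "\<dots> = d\<^sup>2 + inverse (real (Suc n))"
      by (rule real_sqrt_pow2) simp
    finally show ?thesis using p(1) by blast
  qed
  then obtain p where pW: "\<And>n. p n \<in> W"
    and pd: "\<And>n. (norm (x - p n))\<^sup>2 < d\<^sup>2 + inverse (real (Suc n))"
    by metis
  have close: "(norm (p m - p n))\<^sup>2 \<le> 2 * inverse (real (Suc m)) + 2 * inverse (real (Suc n))" for m n
  proof -
    have "(1/2) *\<^sub>R (p m + p n) \<in> W"
      using sub pW by (intro subspace_scale subspace_add) auto
    from dle2[OF this] have "d\<^sup>2 \<le> (norm (x - (1/2) *\<^sub>R (p m + p n)))\<^sup>2" .
    moreover have "(norm (p m - p n))\<^sup>2 + 4 * (norm (x - (1/2) *\<^sub>R (p m + p n)))\<^sup>2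
        = 2 * (norm (x - p m))\<^sup>2 + 2 * (norm (x - p n))\<^sup>2"
      by (simp add: power2_norm_eq_inner inner_diff_left inner_diff_right inner_add_left
          inner_add_right inner_commute algebra_simps)
    ultimately show ?thesis using pd[of m] pd[of n] by linarith
  qed
  have "Cauchy p"
  proof (rule metric_CauchyI)
    fix e :: real assume e: "0 < e"
    then obtain M where M: "inverse (real (Suc M)) < e\<^sup>2 / 4"
      using reals_Archimedean[of "e\<^sup>2 / 4"] by auto
    have "dist (p m) (p n) < e" if "M \<le> m" "M \<le> n" for m n
    proof -
      have "inverse (real (Suc m)) \<le> inverse (real (Suc M))"
        "inverse (real (Suc n)) \<le> inverse (real (Suc M))"
        using that by (auto intro!: le_imp_inverse_le)
      then have "(norm (p m - p n))\<^sup>2 < e\<^sup>2" using close[of m n] M by linarith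
      then show ?thesis using e by (simp add: dist_norm power_less_imp_less_base)
    qed
    then show "\<exists>M. \<forall>m\<ge>M. \<forall>n\<ge>M. dist (p m) (p n) < e" by blast
  qed
  then obtain q where q: "p \<longlonglongrightarrow> q" by (auto simp: Cauchy_convergent_iff convergent_def)
  have qW: "q \<in> W" using closed_sequentially[OF cl _ q] pW by blast
  have "(\<lambda>n. (norm (x - p n))\<^sup>2) \<longlonglongrightarrow> (norm (x - q))\<^sup>2"
    by (intro tendsto_intros q)
  moreover have "(\<lambda>n. d\<^sup>2 + inverse (real (Suc n))) \<longlonglongrightarrow> d\<^sup>2 + 0"
    by (intro tendsto_intros LIMSEQ_inverse_real_of_nat)
  ultimately have qd: "(norm (x - q))\<^sup>2 \<le> d\<^sup>2"
    using LIMSEQ_le pd less_imp_le by (metis (no_types, lifting) add.right_neutral)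
  have "inner (x - q) y = 0" if y: "y \<in> W" for y
  proof (cases "y = 0")
    case False
    \<comment> \<open>The step length minimizes the residual along the line through \<open>q\<close> in direction \<open>y\<close>.\<close>
    define t where "t = inner (x - q) y / inner y y"
    have "q + t *\<^sub>R y \<in> W" using sub qW y by (intro subspace_add subspace_scale)
    from order_trans[OF qd dle2[OF this]]
    have "(norm (x - q))\<^sup>2 \<le> (norm (x - (q + t *\<^sub>R y)))\<^sup>2" .
    also have "\<dots> = (norm (x - q))\<^sup>2 - 2 * t * inner (x - q) y + t * (t * inner y y)"
      by (simp add: power2_norm_eq_inner inner_diff_left inner_diff_right inner_add_left
          inner_add_right inner_commute algebra_simps)
    also have "t * inner y y = inner (x - q) y" using False by (simp add: t_def)
    finally have "t * inner (x - q) y \<le> 0" by simp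
    then have "inner y y * (t * inner (x - q) y) \<le> 0"
      using inner_ge_zero[of y] by (rule mult_nonneg_nonpos[rotated])
    moreover have "inner y y * (t * inner (x - q) y) = (inner (x - q) y)\<^sup>2"
      using False by (simp add: t_def power2_eq_square)
    ultimately have "(inner (x - q) y)\<^sup>2 \<le> 0" by simp
    then show ?thesis by simp
  qed simp
  then show ?thesis using qW by blast
qed

lemma proj_eqI:
  fixes C :: "'a::real_inner set"
  assumes sub: "subspace C" and p: "p \<in> C" and orth: "\<And>y. y \<in> C \<Longrightarrow> inner (x - p) y = 0"
  shows "proj C x = p"
  unfolding proj_def
proof (rule the_equality)
  have pyth: "(norm (x - y))\<^sup>2 = (norm (x - p))\<^sup>2 + (norm (p - y))\<^sup>2" if "y \<in> C" for y
  proof -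
    have "inner (x - p) (p - y) = 0" using orth[OF subspace_diff[OF sub p that]] .
    then show ?thesis using norm_add_Pythagorean[of "x - p" "p - y"] by (simp add: orthogonal_def)
  qed
  show "best_approx C x p"
    unfolding best_approx_def dist_norm
  proof (intro conjI ballI p)
    fix y assume "y \<in> C"
    then show "norm (x - p) \<le> norm (x - y)"
      by (simp add: power2_le_imp_le pyth)
  qed
  fix q assume q: "best_approx C x q"
  then have "norm (x - q) \<le> norm (x - p)" "q \<in> C" using p by (auto simp: best_approx_def dist_norm)
  then have "(norm (x - q))\<^sup>2 \<le> (norm (x - p))\<^sup>2" by (intro power_mono) auto
  then have "(norm (p - q))\<^sup>2 \<le> 0" using pyth[OF \<open>q \<in> C\<close>] by simp
  then show "q = p" by simp
qed

context
  fixes W :: "'a::{real_inner, complete_space} set"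
  assumes W: "subspace W" "closed W"
begin

lemma proj_in_and_orthogonal: "proj W x \<in> W \<and> (\<forall>y\<in>W. inner (x - proj W x) y = 0)"
  using closed_subspace_orthogonal_decomposition[OF W, of x] proj_eqI[OF W(1), of _ x] by metis

lemma proj_cong_inner:
  assumes "\<And>w. w \<in> W \<Longrightarrow> inner x w = inner y w"
  shows "proj W x = proj W y"
  using proj_in_and_orthogonal[of y] assms
  by (intro proj_eqI[OF W(1)]) (auto simp: inner_diff_left)

lemma bounded_linear_proj: "bounded_linear (proj W)"
proof (rule bounded_linear_intro[where K = 1])
  fix x y :: 'a and r :: real
  show "proj W (x + y) = proj W x + proj W y"
    using proj_in_and_orthogonal[of x] proj_in_and_orthogonal[of y] W
    by (intro proj_eqI) (auto simp: subspace_add inner_diff_left inner_add_left)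
  show "proj W (r *\<^sub>R x) = r *\<^sub>R proj W x"
    using proj_in_and_orthogonal[of x] W
    by (intro proj_eqI) (auto simp: subspace_scale inner_diff_left)
  have "orthogonal (x - proj W x) (proj W x)"
    using proj_in_and_orthogonal[of x] by (auto simp: orthogonal_def)
  from norm_add_Pythagorean[OF this] have "(norm (proj W x))\<^sup>2 \<le> (norm x)\<^sup>2" by simp
  from power2_le_imp_le[OF this norm_ge_zero] show "norm (proj W x) \<le> norm x * 1" by simp
qed

lemma proj_orthogonal_comp: "proj (orthogonal_comp W) x = x - proj W x"
  using proj_in_and_orthogonal[of x]
  by (intro proj_eqI[OF subspace_orthogonal_comp])
    (auto simp: orthogonal_comp_def orthogonal_def inner_commute)

end

section \<open>Circumcenters of finite sets on a sphere\<close>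

text \<open>One Gram--Schmidt step per point: the new point \<open>a\<close> is replaced by its residual \<open>a - b\<close>, and
  subtracting a multiple of this residual keeps the orthogonality to \<open>K\<close> already achieved. If the
  residual is zero, the division by zero gives the coefficient 0, as it should.\<close>

lemma finite_span_orthogonal_decomposition:
  fixes K :: "'a::real_inner set"
  assumes "finite K"
  shows "\<exists>p\<in>span K. \<forall>y\<in>K. inner (x - p) y = 0"
  using assms
proof (induction K arbitrary: x)
  case empty
  then show ?case by auto
next
  case (insert a K)
  obtain p where p: "p \<in> span K" "\<forall>y\<in>K. inner (x - p) y = 0" using insert.IH by blast
  obtain b where b: "b \<in> span K" "\<forall>y\<in>K. inner (a - b) y = 0" using insert.IH by blast
  define t where "t = inner (x - p) (a - b) / inner (a - b) (a - b)"
  have t: "t * inner (a - b) (a - b) = inner (x - p) (a - b)" by (simp add: t_def)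
  define q where "q = p + t *\<^sub>R (a - b)"
  have mono: "z \<in> span (insert a K)" if "z \<in> span K" for z
    using that span_mono[of K "insert a K"] by blast
  have "q \<in> span (insert a K)"
    unfolding q_def using mono[OF p(1)] mono[OF b(1)]
    by (simp add: span_add span_scale span_diff span_base)
  moreover have K: "\<forall>y\<in>K. inner (x - q) y = 0"
    using p(2) b(2) by (simp add: q_def diff_diff_eq[symmetric] inner_diff_left)
  moreover have "inner (x - q) a = 0"
  proof -
    have "orthogonal (x - q) b"
      using orthogonal_to_span[OF b(1), of "x - q"] K by (auto simp: orthogonal_def)
    moreover have "inner (x - q) (a - b) = 0"
      using t by (simp add: q_def diff_diff_eq[symmetric] inner_diff_left)
    ultimately show ?thesis by (simp add: orthogonal_def inner_diff_right)
  qed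
  ultimately show ?case by blast
qed

text \<open>The difference of the squared distances from two points is an affine function of the third
  point. Being constant on \<open>K\<close>, it is constant on the affine hull.\<close>

lemma equidistant_points_orthogonal_hull:
  fixes K :: "'a::real_inner set"
  assumes p: "\<And>y y'. y \<in> K \<Longrightarrow> y' \<in> K \<Longrightarrow> dist p y = dist p y'"
    and z: "\<And>y y'. y \<in> K \<Longrightarrow> y' \<in> K \<Longrightarrow> dist z y = dist z y'"
    and uv: "u \<in> affine hull K" "v \<in> affine hull K"
  shows "inner (z - p) (u - v) = 0"
proof -
  obtain a where a: "a \<in> K" using uv by fastforce
  have "inner (z - p) y = inner (z - p) a" if "y \<in> K" for y
  proof -
    have "(norm (p - y))\<^sup>2 = (norm (p - a))\<^sup>2" "(norm (z - y))\<^sup>2 = (norm (z - a))\<^sup>2"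
      using p[OF that a] z[OF that a] by (simp_all add: dist_norm)
    then show ?thesis
      by (simp add: power2_norm_eq_inner inner_diff_left inner_diff_right inner_commute)
  qed
  then have "affine hull K \<subseteq> {y. inner (z - p) y = inner (z - p) a}"
    by (intro hull_minimal affine_hyperplane) auto
  then have "inner (z - p) u = inner (z - p) a" "inner (z - p) v = inner (z - p) a" using uv by blast+
  then show ?thesis by (simp add: inner_diff_right)
qed

lemma circumcenter_unique:
  fixes K :: "'a::real_inner set"
  assumes "is_circumcenter K p" "is_circumcenter K q"
  shows "p = q"
proof -
  have "inner (q - p) (q - p) = 0"
    using assms unfolding is_circumcenter_def
    by (intro equidistant_points_orthogonal_hull[of K]) blast+
  then show ?thesis by simp
qed

lemma circumcenter_exists:
  fixes K :: "'a::real_inner set"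
  assumes "finite K" "K \<noteq> {}" and z: "\<And>y. y \<in> K \<Longrightarrow> dist z y = r"
  shows "\<exists>p. is_circumcenter K p"
proof -
  obtain a where a: "a \<in> K" using assms(2) by blast
  let ?D = "(\<lambda>y. -a + y) ` K"
  obtain q where q: "q \<in> span ?D" "\<forall>y\<in>?D. inner (z - a - q) y = 0"
    using finite_span_orthogonal_decomposition[of ?D "z - a"] assms(1) by auto
  \<comment> \<open>The foot \<open>a + q\<close> of the perpendicular from \<open>z\<close> to the hull.\<close>
  define p where "p = a + q"
  have aff: "p \<in> affine hull K"
    using q(1) affine_hull_span_gen[OF hull_inc[OF a, of affine]] by (auto simp: p_def)
  have "(dist p y)\<^sup>2 = r\<^sup>2 - (norm (z - p))\<^sup>2" if y: "y \<in> K" for y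
  proof -
    have "orthogonal (z - p) (- a + y)"
      using q(2) y by (auto simp: p_def orthogonal_def diff_diff_eq)
    moreover have "orthogonal (z - p) q"
      using orthogonal_to_span[OF q(1), of "z - p"] q(2)
      by (auto simp: p_def orthogonal_def diff_diff_eq)
    ultimately have "orthogonal (z - p) (p - y)"
      by (simp add: p_def orthogonal_def inner_simps)
    from norm_add_Pythagorean[OF this] show ?thesis
      using z[OF y] by (simp add: dist_norm)
  qed
  then have "\<forall>y\<in>K. \<forall>y'\<in>K. dist p y = dist p y'"
    by (metis zero_le_dist power2_eq_iff_nonneg)
  then show ?thesis using aff by (auto simp: is_circumcenter_def)
qed

lemma circumcenter_nearest:
  fixes K :: "'a::real_inner set"
  assumes p: "is_circumcenter K p" and z: "\<And>y. y \<in> K \<Longrightarrow> dist z y = r"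
    and u: "u \<in> affine hull K"
  shows "norm (p - z) \<le> norm (u - z)"
proof -
  have "inner (z - p) (p - u) = 0"
  proof (rule equidistant_points_orthogonal_hull[of K])
    show "dist z y = dist z y'" if "y \<in> K" "y' \<in> K" for y y'
      using z[OF that(1)] z[OF that(2)] by simp
  qed (use p u in \<open>unfold is_circumcenter_def, blast+\<close>)
  then have "(norm (z - u))\<^sup>2 = (norm (z - p))\<^sup>2 + (norm (p - u))\<^sup>2"
    using norm_add_Pythagorean[of "z - p" "p - u"] by (simp add: orthogonal_def)
  then show ?thesis
    by (metis norm_minus_commute le_add_same_cancel1 power2_le_imp_le norm_ge_zero zero_le_power2)
qed

section \<open>The circumcenter mapping\<close>

lemma linear_isometry_inner:
  fixes f :: "'a::real_inner \<Rightarrow> 'a"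
  assumes "linear f" "is_isometry f"
  shows "inner (f x) (f y) = inner x y"
proof -
  have "norm (f u) = norm u" for u
    using assms(2)[unfolded is_isometry_def, rule_format, of u 0] linear_0[OF assms(1)] by simp
  then show ?thesis by (simp add: dot_norm flip: linear_add[OF assms(1)])
qed

context
  fixes S :: "('a::real_inner \<Rightarrow> 'a) set" and W :: "'a set"
  assumes S: "finite S" "S \<noteq> {}"
    and iso: "\<forall>f\<in>S. is_isometry f"
    and fixed: "\<forall>f\<in>S. \<forall>w\<in>W. f w = w"
begin

lemma orbit_set_on_sphere:
  assumes "w \<in> W" "y \<in> orbit_set S x"
  shows "dist w y = dist w x"
proof -
  obtain f where f: "f \<in> S" "y = f x" using assms(2) by (auto simp: orbit_set_def)
  have "norm (f w - f x) = norm (w - x)" using iso f(1) by (simp add: is_isometry_def)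
  then show ?thesis using bspec[OF bspec[OF fixed f(1)] assms(1)] by (simp add: f(2) dist_norm)
qed

lemma CC_is_circumcenter:
  assumes "w \<in> W"
  shows "is_circumcenter (orbit_set S x) (CC S x)"
proof -
  have "orbit_set S x = (\<lambda>f. f x) ` S" by (auto simp: orbit_set_def)
  with S have "finite (orbit_set S x)" "orbit_set S x \<noteq> {}" by simp_all
  then have "\<exists>p. is_circumcenter (orbit_set S x) p"
    using orbit_set_on_sphere[OF assms] by (rule circumcenter_exists)
  then show ?thesis unfolding CC_def using circumcenter_unique by (metis the_equality)
qed

lemma CC_nearest:
  assumes "w \<in> W" "u \<in> affine hull (orbit_set S x)"
  shows "norm (CC S x - w) \<le> norm (u - w)"
  using CC_is_circumcenter[OF assms(1)] orbit_set_on_sphere[OF assms(1)] assms(2)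
  by (rule circumcenter_nearest)

text \<open>All points of the orbit set have the same inner product with a common fixed point, and the
  level sets of \<open>inner w\<close> are affine, so the circumcenter lies in the same level set.\<close>

lemma inner_CC_fixed:
  assumes lin: "\<forall>f\<in>S. linear f" and w: "w \<in> W"
  shows "inner (CC S x) w = inner x w"
proof -
  have "inner w (f x) = inner w x" if "f \<in> S" for f
    using linear_isometry_inner[of f w x] lin iso bspec[OF bspec[OF fixed that] w] that by simp
  then have "orbit_set S x \<subseteq> {y. inner w y = inner w x}" by (auto simp: orbit_set_def)
  then have "affine hull (orbit_set S x) \<subseteq> {y. inner w y = inner w x}"
    by (intro hull_minimal affine_hyperplane)
  then show ?thesis
    using CC_is_circumcenter[OF w, of x] by (auto simp: is_circumcenter_def inner_commute)
qed

end

section \<open>Linear convergence\<close>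

theorem theorem5p10:
  fixes m :: nat
    and Ts :: "nat \<Rightarrow> 'a::{real_inner, complete_space} \<Rightarrow> 'a"
    and S :: "('a \<Rightarrow> 'a) set"
    and W :: "'a set"
    and F T :: "'a \<Rightarrow> 'a"
    and \<gamma> :: real
  assumes "m \<noteq> 0"
    and "\<forall>i\<in>{1..m}. linear (Ts i) \<and> is_isometry (Ts i)"
    and "Ts 1 = id"
    and "S = Ts ` {1..m}"
    and "subspace W" and "closed W"
    and "W \<subseteq> (\<Inter>i\<in>{1..m}. Fix (Ts i))"
    and "\<forall>x. F x \<in> affine hull (orbit_set S x)"
    and "bounded_linear T"
    and "proj W \<circ> T = proj W" and "proj W = T \<circ> proj W"
    and "0 \<le> \<gamma>" and "\<gamma> < 1"
    and "(\<forall>x. norm (F x - proj W x) \<le> \<gamma> * norm (x - proj W x)) \<or>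
      (proj_defined (Fix F) \<and>
       (\<forall>x. norm (F x - proj (Fix F) x) \<le> \<gamma> * norm (x - proj (Fix F) x)) \<and>
       (\<forall>k::nat. proj (Fix F) \<circ> (CC S ^^ k) \<circ> T = proj W))"
  shows "\<forall>x. \<forall>k::nat. norm ((CC S ^^ k) (T x) - proj W x)
      \<le> \<gamma> ^ k * onorm (T \<circ> proj (orthogonal_comp W)) * norm (x - proj W x)"
proof -
  note W = \<open>subspace W\<close> \<open>closed W\<close>
  note projW = proj_in_and_orthogonal[OF W]
  have S: "finite S" "S \<noteq> {}" using \<open>S = Ts ` {1..m}\<close> \<open>m \<noteq> 0\<close> by auto
  have lin: "\<forall>f\<in>S. linear f" and iso: "\<forall>f\<in>S. is_isometry f"
    using \<open>S = Ts ` {1..m}\<close> assms(2) by auto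
  have fixed: "\<forall>f\<in>S. \<forall>w\<in>W. f w = w"
    using \<open>S = Ts ` {1..m}\<close> assms(7) by (auto simp: Fix_def)
  have near: "norm (CC S y - proj W x) \<le> norm (F y - proj W x)" for x y
    using CC_nearest[OF S iso fixed] projW assms(8) by blast
  have PT: "proj W (T x) = proj W x" and TP: "T (proj W x) = proj W x" for x
    using assms(10,11) by (metis comp_apply)+
  have proj_iterate: "proj W ((CC S ^^ k) y) = proj W y" for k y
  proof (induction k)
    case (Suc k)
    have "proj W (CC S z) = proj W z" for z
      by (rule proj_cong_inner[OF W])
        (rule inner_CC_fixed[OF S iso fixed lin])
    with Suc show ?case by simp
  qed simp
  have contract: "norm (F ((CC S ^^ k) (T x)) - proj W x) \<le> \<gamma> * norm ((CC S ^^ k) (T x) - proj W x)"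
    for x k
    using assms(14)
  proof
    assume "\<forall>x. norm (F x - proj W x) \<le> \<gamma> * norm (x - proj W x)"
    from this[rule_format, of "(CC S ^^ k) (T x)"] show ?thesis
      by (simp add: proj_iterate PT)
  next
    assume *: "proj_defined (Fix F) \<and>
       (\<forall>x. norm (F x - proj (Fix F) x) \<le> \<gamma> * norm (x - proj (Fix F) x)) \<and>
       (\<forall>k::nat. proj (Fix F) \<circ> (CC S ^^ k) \<circ> T = proj W)"
    then have "proj (Fix F) ((CC S ^^ k) (T x)) = proj W x" by (metis comp_apply)
    with * show ?thesis by metis
  qed
  have rate: "norm ((CC S ^^ k) (T x) - proj W x) \<le> \<gamma> ^ k * norm (T x - proj W x)" for x k
  proof (induction k)
    case (Suc k)
    have "norm ((CC S ^^ Suc k) (T x) - proj W x) \<le> norm (F ((CC S ^^ k) (T x)) - proj W x)"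
      by (simp add: near)
    also note contract
    also have "\<gamma> * norm ((CC S ^^ k) (T x) - proj W x) \<le> \<gamma> * (\<gamma> ^ k * norm (T x - proj W x))"
      using Suc \<open>0 \<le> \<gamma>\<close> by (rule mult_left_mono)
    finally show ?case by (simp add: mult.assoc)
  qed simp
  let ?Q = "T \<circ> proj (orthogonal_comp W)"
  have "?Q = (\<lambda>x. T (x - proj W x))"
    by (simp add: fun_eq_iff proj_orthogonal_comp[OF W])
  then have Q: "bounded_linear ?Q"
    using bounded_linear_compose[OF \<open>bounded_linear T\<close>
        bounded_linear_sub[OF bounded_linear_ident bounded_linear_proj[OF W]]] by simp
  have initial: "norm (T x - proj W x) \<le> onorm ?Q * norm (x - proj W x)" for x
  proof -
    have "proj W (x - proj W x) = 0"
      using projW[of x] W by (intro proj_eqI) (auto simp: subspace_0)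
    then have "?Q (x - proj W x) = T x - proj W x"
      by (simp add: proj_orthogonal_comp[OF W] TP
          linear_diff[OF bounded_linear.linear[OF \<open>bounded_linear T\<close>]])
    then show ?thesis using onorm[OF Q, of "x - proj W x"] by simp
  qed
  show ?thesis
  proof (intro allI)
    fix x and k :: nat
    have "\<gamma> ^ k * norm (T x - proj W x) \<le> \<gamma> ^ k * (onorm ?Q * norm (x - proj W x))"
      using initial \<open>0 \<le> \<gamma>\<close> by (intro mult_left_mono) auto
    with rate[of k x] show "norm ((CC S ^^ k) (T x) - proj W x)
        \<le> \<gamma> ^ k * onorm ?Q * norm (x - proj W x)" by (simp add: mult.assoc)
  qed
qed

end
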